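(* Let $\boldsymbol{t}=\{t_k\}_{k\geq1}\subset[0,\frac{\pi}{4}]$ be a sequence decreasing to $0$ and let $\boldsymbol{e}=\{e_k\}_{k\geq1}\subset(0,1]$ be any sequence. For each $k\geq1$ let $R_k\subset\mathbb{R}^2$ be a rectangle with eccentricity and orientation $(e_{R_k},\omega_{R_k})=(e_k,t_k)$, and let $\mathcal{B}=\{R_k\}_{k\geq1}$. Suppose there is a constant $C>0$ such that $t_k\leq Ce_k$ for every $k\geq1$. Then the geometric maximal operator $M_{\mathcal{B}}$ is a good operator, i.e. it is bounded on $L^p(\mathbb{R}^2)$ for every $p>1$.
   Context: $|A|$ denotes the Lebesgue measure of a measurable set $A\subset\mathbb{R}^2$. For a (nondegenerate) rectangle $R\subset\mathbb{R}^2$, its orientation $\omega_R\in[0,\pi)$ is the angle its longest side makes with the $Ox$-axis (for a square either side direction may be taken as the longest one), and its eccentricity $e_R\in(0,1]$ is the ratio of its shortest side to its longest side. For a non-empty family $\mathcal{B}$ of rectangles, set $$\mathcal{B}^*=\{\vec t+hR:\ \vec t\in\mathbb{R}^2,\ h>0,\ R\in\mathcal{B}\},$$ and define the geometric maximal operator generated by $\mathcal{B}$ by $$M_{\mathcal{B}}f(x)=\sup_{x\in R\in\mathcal{B}^*}\frac{1}{|R|}\int_R|f|,\qquad f\in L^1_{loc}(\mathbb{R}^2),\ x\in\mathbb{R}^2.$$ For $p\in(1,\infty]$ let $\|M_{\mathcal{B}}\|_p=\sup_{\|f\|_p=1}\|M_{\mathcal{B}}f\|_p$; $M_{\mathcal{B}}$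 is bounded on $L^p(\mathbb{R}^2)$ if $\|M_{\mathcal{B}}\|_p<\infty$. *)

theory Defs
  imports "HOL-Analysis.Analysis" "HOL-Probability.Essential_Supremum"
begin

text \<open>Closed rectangle with centre \<open>c\<close>, having a side of length \<open>a\<close> in direction
  \<open>(cos \<theta>, sin \<theta>)\<close> and a side of length \<open>b\<close> in the orthogonal direction.\<close>

definition rectangle :: "real^2 \<Rightarrow> real \<Rightarrow> real \<Rightarrow> real \<Rightarrow> (real^2) set" where
  "rectangle c \<theta> a b =
     {c + u *\<^sub>R vector [cos \<theta>, sin \<theta>] + v *\<^sub>R vector [- sin \<theta>, cos \<theta>] | u v.
        \<bar>u\<bar> \<le> a / 2 \<and> \<bar>v\<bar> \<le> b / 2}"

text \<open>\<open>R\<close> is a nondegenerate rectangle with eccentricity \<open>e\<close> and orientation \<open>\<omega>\<close>. This is a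
  relation, not a pair of functions, since for a square both side directions count as the
  direction of the longest side.\<close>

definition rectangle_ecc_orient :: "(real^2) set \<Rightarrow> real \<Rightarrow> real \<Rightarrow> bool" where
  "rectangle_ecc_orient R e \<omega> \<longleftrightarrow>
     0 \<le> \<omega> \<and> \<omega> < pi \<and>
     (\<exists>c L l. 0 < l \<and> l \<le> L \<and> R = rectangle c \<omega> L l \<and> e = l / L)"

definition homothets :: "(real^2) set set \<Rightarrow> (real^2) set set" where
  "homothets B = {(\<lambda>x. t + h *\<^sub>R x) ` R | t h R. 0 < h \<and> R \<in> B}"

definition maximal_op :: "(real^2) set set \<Rightarrow> (real^2 \<Rightarrow> real) \<Rightarrow> real^2 \<Rightarrow> ennreal" where
  "maximal_op B f x =
     (SUP R \<in> {R \<in> homothets B. x \<in> R}.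
        (\<integral>\<^sup>+y\<in>R. ennreal \<bar>f y\<bar> \<partial>lebesgue) / emeasure lebesgue R)"

text \<open>Real powers on \<open>[0, \<infinity>]\<close>; only used for exponents \<open>r > 0\<close>.\<close>

definition ennreal_powr :: "ennreal \<Rightarrow> real \<Rightarrow> ennreal" where
  "ennreal_powr x r = (if x = top then top else ennreal (enn2real x powr r))"

definition Lp_norm :: "ennreal \<Rightarrow> (real^2 \<Rightarrow> ennreal) \<Rightarrow> ennreal" where
  "Lp_norm p F =
     (if p = top then esssup lebesgue F
      else ennreal_powr (\<integral>\<^sup>+x. ennreal_powr (F x) (enn2real p) \<partial>lebesgue) (1 / enn2real p))"

definition Lp_op_norm :: "ennreal \<Rightarrow> ((real^2 \<Rightarrow> real) \<Rightarrow> real^2 \<Rightarrow> ennreal) \<Rightarrow> ennreal" where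
  "Lp_op_norm p T =
     (SUP f \<in> {f \<in> borel_measurable lebesgue. Lp_norm p (\<lambda>x. ennreal \<bar>f x\<bar>) = 1}. Lp_norm p (T f))"

definition bounded_on_Lp :: "ennreal \<Rightarrow> ((real^2 \<Rightarrow> real) \<Rightarrow> real^2 \<Rightarrow> ennreal) \<Rightarrow> bool" where
  "bounded_on_Lp p T \<longleftrightarrow> Lp_op_norm p T < top"

text \<open>The exponent \<open>p\<close> ranges over \<open>(1, \<infinity>]\<close>, including \<open>\<infinity>\<close>.\<close>

definition good_operator :: "((real^2 \<Rightarrow> real) \<Rightarrow> real^2 \<Rightarrow> ennreal) \<Rightarrow> bool" where
  "good_operator T \<longleftrightarrow> (\<forall>p>1. bounded_on_Lp p T)"

end

theory Submission
  imports Defs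
begin

text \<open>Since \<open>t\<^sub>k \<le> C e\<^sub>k\<close>, a rectangle with orientation \<open>t\<^sub>k\<close> and sides \<open>L \<ge> l = e\<^sub>k L\<close> lies, around each of
  its points, in an axis-parallel rectangle with sides comparable to \<open>L\<close> and \<open>l\<close>, while its own area
  is at least a constant multiple of \<open>L l\<close>. So the maximal operator is dominated pointwise by a
  multiple of the strong maximal operator, which is the composition of two one-dimensional
  Hardy--Littlewood operators. Each of these is bounded on \<open>L\<^sup>p\<close> by Vitali covering, truncation at
  the level \<open>s / 4\<close> and the layer-cake formula; Tonelli's theorem combines them.\<close>

lemma ennreal_powr_ennreal: "0 \<le> x \<Longrightarrow> ennreal_powr (ennreal x) r = ennreal (x powr r)"
  by (simp add: ennreal_powr_def)

lemma ennreal_powr_mono: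
  assumes "a \<le> b" "0 \<le> r"
  shows "ennreal_powr a r \<le> ennreal_powr b r"
proof (cases "b = top")
  case False
  with assms have "a < top" by (metis order_le_less_trans top.not_eq_extremum)
  then show ?thesis
    using assms False by (auto simp: ennreal_powr_def intro!: ennreal_leI powr_mono2 enn2real_mono
        simp: less_top)
qed (simp add: ennreal_powr_def)

lemma ennreal_powr_mult:
  assumes "0 < r"
  shows "ennreal_powr (a * b) r = ennreal_powr a r * ennreal_powr b r"
proof (cases a; cases b)
  fix x y assume "0 \<le> x" "a = ennreal x" "0 \<le> y" "b = ennreal y"
  then show ?thesis
    by (simp add: ennreal_mult[symmetric] ennreal_powr_ennreal powr_mult)
next
  fix x assume "0 \<le> x" "a = ennreal x" "b = top"
  then show ?thesis
    using assms by (cases "x = 0") (auto simp: ennreal_powr_ennreal ennreal_powr_def ennreal_mult_top ennreal_mult_eq_top_iff)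
next
  fix x assume "a = top" "0 \<le> x" "b = ennreal x"
  then show ?thesis
    using assms by (cases "x = 0") (auto simp: ennreal_powr_ennreal ennreal_powr_def ennreal_top_mult ennreal_mult_eq_top_iff)
qed (simp add: ennreal_powr_def)

lemma ennreal_powr_inverse:
  assumes "0 < r"
  shows "ennreal_powr (ennreal_powr x (1 / r)) r = x"
  using assms by (cases x) (auto simp: ennreal_powr_def powr_powr)

lemma ennreal_powr_measurable [measurable]:
  assumes [measurable]: "f \<in> borel_measurable M"
  shows "(\<lambda>x. ennreal_powr (f x) r) \<in> borel_measurable M"
  unfolding ennreal_powr_def by measurable

lemma nn_integral_powr_Ioo:
  assumes "0 < r" "0 \<le> c"
  shows "(\<integral>\<^sup>+s. ennreal (r * s powr (r - 1)) * indicator {0<..<c} s \<partial>lborel) = ennreal (c powr r)"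
proof -
  have "((\<lambda>s. s powr (r - 1)) has_integral (c powr (r - 1 + 1) / (r - 1 + 1))) {0..c}"
    by (rule has_integral_powr_from_0) (use assms in auto)
  then have "((\<lambda>s. r * s powr (r - 1)) has_integral (r * (c powr r / r))) {0..c}"
    by (intro has_integral_mult_right) simp
  then have "((\<lambda>s. r * s powr (r - 1)) has_integral (c powr r)) {0<..<c}"
    using assms by (simp add: has_integral_Icc_iff_Ioo)
  from nn_integral_has_integral_lebesgue'[OF _ this] show ?thesis
    using assms by simp
qed

lemma nn_integral_layer_cake:
  assumes "0 < r"
  shows "(\<integral>\<^sup>+s. ennreal (r * s powr (r - 1)) * indicator {s. 0 < s \<and> ennreal s < g} s \<partial>lborel)
    = ennreal_powr g r"
proof (cases g)
  case (real c)
  then have "{s. 0 < s \<and> ennreal s < g} = {0<..<c}"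
    by (auto simp: ennreal_less_iff)
  then show ?thesis
    using nn_integral_powr_Ioo[OF assms] real by (simp add: ennreal_powr_ennreal)
next
  case top
  let ?I = "\<integral>\<^sup>+s. ennreal (r * s powr (r - 1)) * indicator {s. 0 < s \<and> ennreal s < g} s \<partial>lborel"
  have "ennreal x \<le> ?I" if "0 \<le> x" for x
  proof -
    have "ennreal x = ennreal ((x powr (1 / r)) powr r)"
      using assms that by (simp add: powr_powr)
    also have "\<dots> = (\<integral>\<^sup>+s. ennreal (r * s powr (r - 1)) * indicator {0<..<x powr (1 / r)} s \<partial>lborel)"
      by (rule nn_integral_powr_Ioo[symmetric]) (use assms in auto)
    also have "\<dots> \<le> ?I"
      by (intro nn_integral_mono) (auto simp: indicator_def top)
    finally show ?thesis .
  qed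
  from this[of "enn2real ?I + 1"] have "?I = top"
    by (cases ?I) auto
  then show ?thesis
    by (simp add: top ennreal_powr_def)
qed

lemma cball_borel_measurable [measurable]: "cball x r \<in> sets borel"
  by simp

text \<open>Only dyadic radii are used, so that the supremum is countable and hence measurable; this
  costs a factor 2 in \<open>hl_max_ge\<close>. The average is normalised by the radius.\<close>

definition hl_max :: "(real \<Rightarrow> ennreal) \<Rightarrow> real \<Rightarrow> ennreal" where
  "hl_max f x = (SUP n::int. ennreal (2 powr - real_of_int n) * (\<integral>\<^sup>+y\<in>cball x (2 powr n). f y \<partial>lborel))"

lemma hl_max_measurable2:
  assumes [measurable]: "(\<lambda>(w, y). f w y) \<in> borel_measurable (N \<Otimes>\<^sub>M borel)"
  shows "(\<lambda>(w, x). hl_max (f w) x) \<in> borel_measurable (N \<Otimes>\<^sub>M borel)"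
proof -
  have [measurable]: "(\<lambda>p. indicator (cball (snd (fst p)) c) (snd p) :: ennreal)
      \<in> borel_measurable ((N \<Otimes>\<^sub>M borel) \<Otimes>\<^sub>M (lborel :: real measure))" for c :: real
    unfolding mem_cball indicator_def by measurable
  have [measurable]: "(\<lambda>p. f (fst (fst p)) (snd p)) \<in> borel_measurable ((N \<Otimes>\<^sub>M borel) \<Otimes>\<^sub>M (lborel :: real measure))"
    by measurable
  show ?thesis
    unfolding hl_max_def split_beta by measurable
qed

lemma hl_max_measurable [measurable]:
  assumes [measurable]: "f \<in> borel_measurable borel"
  shows "hl_max f \<in> borel_measurable borel"
proof -
  have "(\<lambda>(w, x). hl_max f x) \<in> borel_measurable (count_space {()} \<Otimes>\<^sub>M borel)"
    by (rule hl_max_measurable2) measurable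
  then have "(\<lambda>x. (case ((), x) of (w, x) \<Rightarrow> hl_max f x)) \<in> borel_measurable borel"
    by (rule measurable_compose[rotated]) measurable
  then show ?thesis by simp
qed

lemma ex_dyadic_radius:
  fixes a :: real
  assumes "0 < a"
  obtains n :: int where "a \<le> 2 powr n" "2 powr n \<le> 2 * a"
proof
  show "a \<le> 2 powr \<lceil>log 2 a\<rceil>"
    using assms by (simp add: le_powr_iff le_log_iff log_le_iff)
  have "2 powr \<lceil>log 2 a\<rceil> \<le> 2 powr (log 2 a + 1)"
    by (intro powr_mono) linarith+
  then show "2 powr \<lceil>log 2 a\<rceil> \<le> 2 * a"
    using assms by (simp add: powr_add)
qed

lemma hl_max_ge:
  assumes "0 < a"
  shows "(\<integral>\<^sup>+y\<in>cball x a. f y \<partial>lborel) \<le> ennreal (2 * a) * hl_max f x"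
proof -
  obtain n :: int where n: "a \<le> 2 powr n" "2 powr n \<le> 2 * a"
    using ex_dyadic_radius[OF assms] .
  let ?I = "\<integral>\<^sup>+y\<in>cball x (2 powr n). f y \<partial>lborel"
  have "(\<integral>\<^sup>+y\<in>cball x a. f y \<partial>lborel) \<le> ?I"
    using n by (intro nn_integral_mono) (auto simp: indicator_def)
  also have "\<dots> = ennreal (2 powr n) * (ennreal (2 powr - real_of_int n) * ?I)"
    by (simp add: mult.assoc[symmetric] ennreal_mult[symmetric] powr_add[symmetric])
  also have "\<dots> \<le> ennreal (2 * a) * hl_max f x"
    unfolding hl_max_def by (intro mult_mono ennreal_leI n SUP_upper) auto
  finally show ?thesis .
qed

lemma hl_max_mono: "(\<And>y. f y \<le> g y) \<Longrightarrow> hl_max f x \<le> hl_max g x"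
  unfolding hl_max_def
  by (intro SUP_mono' mult_left_mono nn_integral_mono mult_right_mono) auto

lemma emeasure_cball_real: "0 \<le> r \<Longrightarrow> emeasure lborel (cball x r :: real set) = ennreal (2 * r)"
  by (simp add: cball_eq_atLeastAtMost)

lemma hl_max_add_const:
  assumes [measurable]: "f \<in> borel_measurable borel"
  shows "hl_max (\<lambda>y. f y + c) x \<le> hl_max f x + 2 * c"
  unfolding hl_max_def[of "\<lambda>y. f y + c"]
proof (rule SUP_least)
  fix n :: int
  have "(\<integral>\<^sup>+y\<in>cball x (2 powr n). (f y + c) \<partial>lborel)
      = (\<integral>\<^sup>+y\<in>cball x (2 powr n). f y \<partial>lborel) + c * ennreal (2 * 2 powr n)"
    unfolding distrib_right
    by (subst nn_integral_add, measurable) (simp add: nn_integral_cmult_indicator emeasure_cball_real)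
  also have "ennreal (2 powr - real_of_int n) * \<dots>
      = ennreal (2 powr - real_of_int n) * (\<integral>\<^sup>+y\<in>cball x (2 powr n). f y \<partial>lborel)
        + c * (ennreal (2 powr - real_of_int n) * ennreal (2 * 2 powr n))"
    by (simp add: distrib_left ac_simps)
  also have "ennreal (2 powr - real_of_int n) * ennreal (2 * 2 powr n) = ennreal 2"
    by (subst ennreal_mult[symmetric]) (auto simp: powr_minus field_simps simp del: ennreal_numeral)
  also have "ennreal (2 powr - real_of_int n) * (\<integral>\<^sup>+y\<in>cball x (2 powr n). f y \<partial>lborel) \<le> hl_max f x"
    unfolding hl_max_def by (rule SUP_upper) simp
  finally show "ennreal (2 powr - real_of_int n) * (\<integral>\<^sup>+y\<in>cball x (2 powr n). (f y + c) \<partial>lborel)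
      \<le> hl_max f x + 2 * c"
    by (simp add: mult.commute)
qed

lemma emeasure_UN_countable_subadditive:
  assumes X: "\<And>i. i \<in> I \<Longrightarrow> X i \<in> sets M" and I: "countable I"
  shows "emeasure M (\<Union>i\<in>I. X i) \<le> (\<integral>\<^sup>+i. emeasure M (X i) \<partial>count_space I)"
proof -
  have "(\<Union>i\<in>I. X i) \<in> sets M"
    using X I by (intro sets.countable_UN'') auto
  then have "emeasure M (\<Union>i\<in>I. X i) = (\<integral>\<^sup>+x. indicator (\<Union>i\<in>I. X i) x \<partial>M)"
    by simp
  also have "\<dots> \<le> (\<integral>\<^sup>+x. \<integral>\<^sup>+i. indicator (X i) x \<partial>count_space I \<partial>M)"
  proof (intro nn_integral_mono)
    fix x
    show "indicator (\<Union>i\<in>I. X i) x \<le> (\<integral>\<^sup>+i. indicator (X i) x \<partial>count_space I)"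
    proof (cases "x \<in> (\<Union>i\<in>I. X i)")
      case True
      then obtain i where i: "i \<in> I" "x \<in> X i" by blast
      then show ?thesis
        using nn_integral_ge_point[of i I "\<lambda>i. indicator (X i) x"] True by simp
    qed simp
  qed
  also have "\<dots> = (\<integral>\<^sup>+i. \<integral>\<^sup>+x. indicator (X i) x \<partial>M \<partial>count_space I)"
    using X I by (intro nn_integral_count_space_nn_integral) auto
  also have "\<dots> = (\<integral>\<^sup>+i. emeasure M (X i) \<partial>count_space I)"
    using X by (intro nn_integral_cong) simp
  finally show ?thesis .
qed

lemma hl_max_weak_type:
  assumes [measurable]: "f \<in> borel_measurable borel" and "0 < s"
  shows "ennreal s * emeasure lborel {x. ennreal s < hl_max f x} \<le> 10 * (\<integral>\<^sup>+y. f y \<partial>lborel)"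
proof (cases "\<integral>\<^sup>+y. f y \<partial>lborel")
  case (real I)
  define S where "S = {x. ennreal s < hl_max f x}"
  have "\<exists>n::int. ennreal (s * 2 powr n) \<le> (\<integral>\<^sup>+y\<in>cball x (2 powr n). f y \<partial>lborel)" if x: "x \<in> S" for x
  proof -
    obtain n :: int where "ennreal s < ennreal (2 powr - real_of_int n) * (\<integral>\<^sup>+y\<in>cball x (2 powr n). f y \<partial>lborel)"
      using x unfolding S_def hl_max_def by (auto simp: less_SUP_iff)
    then have "ennreal (2 powr n) * ennreal s
        \<le> ennreal (2 powr n) * (ennreal (2 powr - real_of_int n) * (\<integral>\<^sup>+y\<in>cball x (2 powr n). f y \<partial>lborel))"
      by (intro mult_left_mono) auto
    then show ?thesis
      using assms by (intro exI[of _ n])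
        (simp add: mult.assoc[symmetric] ennreal_mult[symmetric] powr_add[symmetric] mult.commute)
  qed
  then obtain n :: "real \<Rightarrow> int" where
    n: "\<And>x. x \<in> S \<Longrightarrow> ennreal (s * 2 powr n x) \<le> (\<integral>\<^sup>+y\<in>cball x (2 powr n x). f y \<partial>lborel)"
    by metis
  define r where "r x = (2::real) powr n x" for x
  have bnd: "0 < r x \<and> r x \<le> I / s" if "x \<in> S" for x
  proof -
    have "ennreal (s * r x) \<le> (\<integral>\<^sup>+y\<in>cball x (r x). f y \<partial>lborel)"
      using n[OF that] by (simp add: r_def)
    also have "\<dots> \<le> (\<integral>\<^sup>+y. f y \<partial>lborel)"
      by (intro nn_integral_mono) (auto simp: indicator_def)
    finally show ?thesis
      using real assms by (simp add: r_def field_simps)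
  qed
  have cover: "S \<subseteq> (\<Union>x\<in>S. cball x (r x))"
    using bnd by force
  obtain D where D: "countable D" "D \<subseteq> S"
    "pairwise (\<lambda>i j. disjnt (cball i (r i)) (cball j (r j))) D"
    "S \<subseteq> (\<Union>i\<in>D. cball i (5 * r i))"
    by (rule Vitali_covering_lemma_cballs[OF cover bnd])
  have disj: "disjoint_family_on (\<lambda>i. cball i (r i)) D"
    using D(3) by (auto simp: disjoint_family_on_def pairwise_def disjnt_def)
  have "ennreal s * emeasure lborel S \<le> ennreal s * emeasure lborel (\<Union>i\<in>D. cball i (5 * r i))"
    using D by (intro mult_left_mono emeasure_mono) auto
  also have "\<dots> \<le> ennreal s * (\<integral>\<^sup>+i. emeasure lborel (cball i (5 * r i)) \<partial>count_space D)"
    using D(1) by (intro mult_left_mono emeasure_UN_countable_subadditive) auto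
  also have "\<dots> = (\<integral>\<^sup>+i. ennreal s * emeasure lborel (cball i (5 * r i)) \<partial>count_space D)"
    by (simp add: nn_integral_cmult)
  also have "\<dots> \<le> (\<integral>\<^sup>+i. 10 * (\<integral>\<^sup>+y\<in>cball i (r i). f y \<partial>lborel) \<partial>count_space D)"
  proof (intro nn_integral_mono)
    fix i assume "i \<in> space (count_space D)"
    then have "i \<in> S" using D(2) by auto
    have "ennreal s * emeasure lborel (cball i (5 * r i)) = ennreal 10 * ennreal (s * r i)"
      using bnd[OF \<open>i \<in> S\<close>] assms by (simp add: emeasure_cball_real ennreal_mult[symmetric] ac_simps del: ennreal_numeral)
    also have "\<dots> \<le> ennreal 10 * (\<integral>\<^sup>+y\<in>cball i (r i). f y \<partial>lborel)"
      using n[OF \<open>i \<in> S\<close>] by (intro mult_left_mono) (auto simp: r_def)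
    finally show "ennreal s * emeasure lborel (cball i (5 * r i))
        \<le> 10 * (\<integral>\<^sup>+y\<in>cball i (r i). f y \<partial>lborel)" by simp
  qed
  also have "\<dots> = 10 * (\<integral>\<^sup>+i. emeasure (density lborel f) (cball i (r i)) \<partial>count_space D)"
    by (simp add: nn_integral_cmult emeasure_density)
  also have "\<dots> = 10 * emeasure (density lborel f) (\<Union>i\<in>D. cball i (r i))"
    using D disj by (subst emeasure_UN_countable) auto
  also have "\<dots> \<le> 10 * emeasure (density lborel f) (space (density lborel f))"
    by (intro mult_left_mono emeasure_space) auto
  also have "\<dots> = 10 * (\<integral>\<^sup>+y. f y \<partial>lborel)"
    by (simp add: emeasure_density)
  finally show ?thesis
    by (simp add: S_def)
qed (simp add: ennreal_mult_top)

lemma hl_max_weak_type_truncated: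
  assumes [measurable]: "f \<in> borel_measurable borel" and s: "0 < s"
  shows "ennreal s * emeasure lborel {x. ennreal s < hl_max f x}
    \<le> 20 * (\<integral>\<^sup>+y\<in>{y. ennreal s < 4 * f y}. f y \<partial>lborel)"
proof -
  define g where "g y = f y * indicator {y. ennreal s < 4 * f y} y" for y
  have [measurable]: "g \<in> borel_measurable borel"
    unfolding g_def by measurable
  have four: "f y \<le> ennreal (s / 4)" if "\<not> ennreal s < 4 * f y" for y
  proof (cases "f y")
    case (real c)
    then have "4 * f y = ennreal (4 * c)" by (simp add: ennreal_mult)
    then show ?thesis
      using that real s by (simp add: not_less)
  qed (use that in \<open>simp add: ennreal_mult_top\<close>)
  have "f y \<le> g y + ennreal (s / 4)" for y
    using four[of y] by (auto simp: g_def indicator_def)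
  then have "hl_max f x \<le> hl_max (\<lambda>y. g y + ennreal (s / 4)) x" for x
    by (rule hl_max_mono)
  also have "\<dots> x \<le> hl_max g x + 2 * ennreal (s / 4)" for x
    by (rule hl_max_add_const) measurable
  also have "2 * ennreal (s / 4) = ennreal (s / 2)"
    using s by (simp add: ennreal_mult[symmetric] flip: ennreal_numeral)
  finally have le: "hl_max f x \<le> hl_max g x + ennreal (s / 2)" for x .
  have sub: "{x. ennreal s < hl_max f x} \<subseteq> {x. ennreal (s / 2) < hl_max g x}"
  proof safe
    fix x assume "ennreal s < hl_max f x"
    with le[of x] have "ennreal s < hl_max g x + ennreal (s / 2)" by simp
    then show "ennreal (s / 2) < hl_max g x"
      using s by (cases "hl_max g x")
        (auto simp: ennreal_less_iff ennreal_plus[symmetric] simp del: ennreal_plus)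
  qed
  have "ennreal s * emeasure lborel {x. ennreal s < hl_max f x}
      \<le> ennreal s * emeasure lborel {x. ennreal (s / 2) < hl_max g x}"
    using sub by (intro mult_left_mono emeasure_mono) auto
  also have "\<dots> = 2 * (ennreal (s / 2) * emeasure lborel {x. ennreal (s / 2) < hl_max g x})"
    using s by (simp add: mult.assoc[symmetric] ennreal_mult[symmetric] flip: ennreal_numeral)
  also have "\<dots> \<le> 2 * (10 * (\<integral>\<^sup>+y. g y \<partial>lborel))"
    using s by (intro mult_left_mono hl_max_weak_type) auto
  finally show ?thesis
    by (simp add: g_def mult.assoc[symmetric])
qed

lemma hl_max_strong_type:
  assumes [measurable]: "f \<in> borel_measurable borel" and p: "1 < p"
  shows "(\<integral>\<^sup>+x. ennreal_powr (hl_max f x) p \<partial>lborel)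
    \<le> ennreal (20 * p / (p - 1) * 4 powr (p - 1)) * (\<integral>\<^sup>+x. ennreal_powr (f x) p \<partial>lborel)"
proof -
  let ?M = "hl_max f"
  let ?c = "ennreal (20 * p / (p - 1))"
  have [measurable]: "?M \<in> borel_measurable borel" by measurable
  have "(\<integral>\<^sup>+x. ennreal_powr (?M x) p \<partial>lborel)
      = (\<integral>\<^sup>+x. \<integral>\<^sup>+s. ennreal (p * s powr (p - 1)) * indicator {s. 0 < s \<and> ennreal s < ?M x} s \<partial>lborel \<partial>lborel)"
    using p by (simp add: nn_integral_layer_cake)
  also have "\<dots> = (\<integral>\<^sup>+s. \<integral>\<^sup>+x. ennreal (p * s powr (p - 1)) * indicator {s. 0 < s \<and> ennreal s < ?M x} s \<partial>lborel \<partial>lborel)"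
    unfolding indicator_def by (rule lborel_pair.Fubini'[symmetric]) measurable
  also have "\<dots> \<le> (\<integral>\<^sup>+s. \<integral>\<^sup>+x. ?c * f x * (ennreal ((p - 1) * s powr (p - 1 - 1))
      * indicator {s. 0 < s \<and> ennreal s < 4 * f x} s) \<partial>lborel \<partial>lborel)"
  proof (rule nn_integral_mono)
    fix s :: real
    show "(\<integral>\<^sup>+x. ennreal (p * s powr (p - 1)) * indicator {s. 0 < s \<and> ennreal s < ?M x} s \<partial>lborel)
      \<le> (\<integral>\<^sup>+x. ?c * f x * (ennreal ((p - 1) * s powr (p - 1 - 1)) * indicator {s. 0 < s \<and> ennreal s < 4 * f x} s) \<partial>lborel)"
    proof (cases "0 < s")
      case True
      have "(\<integral>\<^sup>+x. ennreal (p * s powr (p - 1)) * indicator {s. 0 < s \<and> ennreal s < ?M x} s \<partial>lborel)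
          = (\<integral>\<^sup>+x. ennreal (p * s powr (p - 1)) * indicator {x. ennreal s < ?M x} x \<partial>lborel)"
        using True by (intro nn_integral_cong) (auto simp: indicator_def)
      also have "\<dots> = ennreal (p * s powr (p - 1)) * emeasure lborel {x. ennreal s < ?M x}"
        by (rule nn_integral_cmult_indicator) measurable
      also have "\<dots> = ennreal (p * s powr (p - 2)) * ennreal s * emeasure lborel {x. ennreal s < ?M x}"
        using True p by (subst ennreal_mult[symmetric]) (auto simp: powr_diff power2_eq_square)
      also have "\<dots>
          \<le> ennreal (p * s powr (p - 2)) * (20 * (\<integral>\<^sup>+y\<in>{y. ennreal s < 4 * f y}. f y \<partial>lborel))"
        unfolding mult.assoc using True by (intro mult_left_mono hl_max_weak_type_truncated) auto
      also have "\<dots> = ennreal (p * s powr (p - 2) * 20) * (\<integral>\<^sup>+y\<in>{y. ennreal s < 4 * f y}. f y \<partial>lborel)"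
        using p by (subst ennreal_mult) (auto simp: mult.assoc)
      also have "ennreal (p * s powr (p - 2) * 20) = ?c * ennreal ((p - 1) * s powr (p - 1 - 1))"
        using p by (subst ennreal_mult[symmetric]) auto
      also have "\<dots> * (\<integral>\<^sup>+y\<in>{y. ennreal s < 4 * f y}. f y \<partial>lborel)
        = (\<integral>\<^sup>+x. ?c * ennreal ((p - 1) * s powr (p - 1 - 1)) * (f x * indicator {y. ennreal s < 4 * f y} x) \<partial>lborel)"
        by (rule nn_integral_cmult[symmetric]) measurable
      also have "\<dots> = (\<integral>\<^sup>+x. ?c * f x * (ennreal ((p - 1) * s powr (p - 1 - 1)) * indicator {s. 0 < s \<and> ennreal s < 4 * f x} s) \<partial>lborel)"
        using True by (intro nn_integral_cong) (auto simp: indicator_def ac_simps)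
      finally show ?thesis .
    qed simp
  qed
  also have "\<dots> = (\<integral>\<^sup>+x. \<integral>\<^sup>+s. ?c * f x * (ennreal ((p - 1) * s powr (p - 1 - 1))
      * indicator {s. 0 < s \<and> ennreal s < 4 * f x} s) \<partial>lborel \<partial>lborel)"
    unfolding indicator_def by (rule lborel_pair.Fubini') measurable
  also have "\<dots> = (\<integral>\<^sup>+x. ?c * f x * ennreal_powr (4 * f x) (p - 1) \<partial>lborel)"
  proof (rule nn_integral_cong)
    fix x
    have "(\<integral>\<^sup>+s. ?c * f x * (ennreal ((p - 1) * s powr (p - 1 - 1))
        * indicator {s. 0 < s \<and> ennreal s < 4 * f x} s) \<partial>lborel)
      = ?c * f x * (\<integral>\<^sup>+s. ennreal ((p - 1) * s powr (p - 1 - 1)) * indicator {s. 0 < s \<and> ennreal s < 4 * f x} s \<partial>lborel)"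
      unfolding indicator_def by (rule nn_integral_cmult) measurable
    then show "(\<integral>\<^sup>+s. ?c * f x * (ennreal ((p - 1) * s powr (p - 1 - 1))
        * indicator {s. 0 < s \<and> ennreal s < 4 * f x} s) \<partial>lborel) = ?c * f x * ennreal_powr (4 * f x) (p - 1)"
      using nn_integral_layer_cake[of "p - 1" "4 * f x"] p by simp
  qed
  also have "\<dots> = (\<integral>\<^sup>+x. ennreal (20 * p / (p - 1) * 4 powr (p - 1)) * ennreal_powr (f x) p \<partial>lborel)"
  proof (rule nn_integral_cong)
    fix x
    have "f x * ennreal_powr (f x) (p - 1) = ennreal_powr (f x) p"
    proof (cases "f x")
      case (real c)
      then show ?thesis
        using p by (cases "c = 0") (auto simp: ennreal_powr_def ennreal_mult[symmetric] powr_diff)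
    qed (simp add: ennreal_powr_def)
    moreover have "ennreal_powr (4 * f x) (p - 1) = ennreal (4 powr (p - 1)) * ennreal_powr (f x) (p - 1)"
      using p ennreal_powr_ennreal[of 4 "p - 1"] by (simp add: ennreal_powr_mult)
    moreover have "?c * f x * (ennreal (4 powr (p - 1)) * ennreal_powr (f x) (p - 1))
        = ?c * ennreal (4 powr (p - 1)) * (f x * ennreal_powr (f x) (p - 1))"
      by (simp add: ac_simps)
    moreover have "ennreal (20 * p / (p - 1) * 4 powr (p - 1)) = ?c * ennreal (4 powr (p - 1))"
      using p by (intro ennreal_mult) auto
    ultimately show "?c * f x * ennreal_powr (4 * f x) (p - 1)
        = ennreal (20 * p / (p - 1) * 4 powr (p - 1)) * ennreal_powr (f x) p"
      by simp
  qed
  also have "\<dots> = ennreal (20 * p / (p - 1) * 4 powr (p - 1)) * (\<integral>\<^sup>+x. ennreal_powr (f x) p \<partial>lborel)"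
    by (rule nn_integral_cmult) measurable
  finally show ?thesis .
qed

lemma vector_2_eq: "(vector [x, y] :: real^2) = x *\<^sub>R axis 1 1 + y *\<^sub>R axis 2 1"
  by (simp add: vec_eq_iff forall_2 axis_def)

lemma vector_2_measurable [measurable]:
  assumes [measurable]: "f \<in> borel_measurable M" "g \<in> borel_measurable M"
  shows "(\<lambda>w. vector [f w, g w] :: real^2) \<in> borel_measurable M"
  unfolding vector_2_eq by measurable

lemma Basis_real_2: "(Basis :: (real^2) set) = {axis 1 1, axis 2 1}"
  by (auto simp: Basis_vec_def UNIV_2)

lemma prod_Basis_real_2: "(\<Prod>b\<in>Basis. f b) = f (axis 1 1) * f (axis 2 1 :: real^2)"
  by (simp add: Basis_real_2 axis_eq_axis)

lemma lborel_real_2: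
  "lborel = distr (lborel \<Otimes>\<^sub>M lborel) borel (\<lambda>(x, y). vector [x, y] :: real^2)"
proof (rule lborel_eqI)
  fix l u :: "real^2"
  assume le: "\<And>b. b \<in> Basis \<Longrightarrow> l \<bullet> b \<le> u \<bullet> b"
  from le[of "axis 1 1"] le[of "axis 2 1"] have le': "l $ 1 \<le> u $ 1" "l $ 2 \<le> u $ 2"
    by (auto simp: inner_axis)
  have "(\<lambda>(x, y). vector [x, y] :: real^2) -` box l u = {l $ 1<..<u $ 1} \<times> {l $ 2<..<u $ 2}"
    by (auto simp: mem_box_cart forall_2)
  then show "emeasure (distr (lborel \<Otimes>\<^sub>M lborel) borel (\<lambda>(x, y). vector [x, y])) (box l u)
      = ennreal (\<Prod>b\<in>Basis. (u - l) \<bullet> b)"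
    using le' by (subst emeasure_distr)
      (auto simp: split_beta space_pair_measure lborel.emeasure_pair_measure_Times prod_Basis_real_2
        inner_axis ennreal_mult)
qed simp

lemma nn_integral_real_2:
  assumes [measurable]: "g \<in> borel_measurable borel"
  shows "(\<integral>\<^sup>+z. g z \<partial>lborel) = (\<integral>\<^sup>+x. \<integral>\<^sup>+y. g (vector [x, y] :: real^2) \<partial>lborel \<partial>lborel)"
  by (subst lborel_real_2) (simp add: nn_integral_distr split_beta lborel.nn_integral_fst[symmetric])

definition strong_max :: "(real \<Rightarrow> real \<Rightarrow> ennreal) \<Rightarrow> real \<Rightarrow> real \<Rightarrow> ennreal" where
  "strong_max F x y = hl_max (\<lambda>u. hl_max (F u) y) x"

context
  fixes F :: "real \<Rightarrow> real \<Rightarrow> ennreal"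
  assumes F [measurable]: "(\<lambda>(x, y). F x y) \<in> borel_measurable (borel \<Otimes>\<^sub>M borel)"
begin

lemma hl_max_snd_measurable [measurable]:
  "(\<lambda>(u, y). hl_max (F u) y) \<in> borel_measurable (borel \<Otimes>\<^sub>M borel)"
  by (rule hl_max_measurable2) measurable

lemma strong_max_measurable [measurable]:
  "(\<lambda>(x, y). strong_max F x y) \<in> borel_measurable (borel \<Otimes>\<^sub>M borel)"
proof -
  have "(\<lambda>(y, x). hl_max (\<lambda>u. hl_max (F u) y) x) \<in> borel_measurable (borel \<Otimes>\<^sub>M borel)"
    by (rule hl_max_measurable2) measurable
  then show ?thesis
    unfolding strong_max_def by (subst measurable_pair_swap_iff) simp
qed

lemma strong_max_strong_type:
  assumes p: "1 < p"
  shows "(\<integral>\<^sup>+x. \<integral>\<^sup>+y. ennreal_powr (strong_max F x y) p \<partial>lborel \<partial>lborel)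
    \<le> ennreal ((20 * p / (p - 1) * 4 powr (p - 1))\<^sup>2)
      * (\<integral>\<^sup>+x. \<integral>\<^sup>+y. ennreal_powr (F x y) p \<partial>lborel \<partial>lborel)"
proof -
  define K where "K = 20 * p / (p - 1) * 4 powr (p - 1)"
  have K: "0 \<le> K" using p by (simp add: K_def)
  note hl = hl_max_strong_type[OF _ p, folded K_def]
  have "(\<integral>\<^sup>+x. \<integral>\<^sup>+y. ennreal_powr (strong_max F x y) p \<partial>lborel \<partial>lborel)
      = (\<integral>\<^sup>+y. \<integral>\<^sup>+x. ennreal_powr (strong_max F x y) p \<partial>lborel \<partial>lborel)"
    by (rule lborel_pair.Fubini'[symmetric]) measurable
  also have "\<dots> \<le> (\<integral>\<^sup>+y. K * (\<integral>\<^sup>+x. ennreal_powr (hl_max (F x) y) p \<partial>lborel) \<partial>lborel)"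
    unfolding strong_max_def by (intro nn_integral_mono hl) measurable
  also have "\<dots> = K * (\<integral>\<^sup>+y. \<integral>\<^sup>+x. ennreal_powr (hl_max (F x) y) p \<partial>lborel \<partial>lborel)"
    by (rule nn_integral_cmult) measurable
  also have "(\<integral>\<^sup>+y. \<integral>\<^sup>+x. ennreal_powr (hl_max (F x) y) p \<partial>lborel \<partial>lborel)
      = (\<integral>\<^sup>+x. \<integral>\<^sup>+y. ennreal_powr (hl_max (F x) y) p \<partial>lborel \<partial>lborel)"
    by (rule lborel_pair.Fubini') measurable
  also have "\<dots> \<le> (\<integral>\<^sup>+x. K * (\<integral>\<^sup>+y. ennreal_powr (F x y) p \<partial>lborel) \<partial>lborel)"
    by (intro nn_integral_mono hl) measurable
  also have "\<dots> = K * (\<integral>\<^sup>+x. \<integral>\<^sup>+y. ennreal_powr (F x y) p \<partial>lborel \<partial>lborel)"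
    by (rule nn_integral_cmult) measurable
  finally show ?thesis
    unfolding K_def[symmetric] using K by (simp add: power2_eq_square ennreal_mult mult.assoc mult_left_mono)
qed

lemma strong_max_ge:
  assumes "0 < a" "0 < b"
  shows "(\<integral>\<^sup>+u\<in>cball x a. \<integral>\<^sup>+v\<in>cball y b. F u v \<partial>lborel \<partial>lborel)
    \<le> ennreal (4 * a * b) * strong_max F x y"
proof -
  have "(\<integral>\<^sup>+u\<in>cball x a. \<integral>\<^sup>+v\<in>cball y b. F u v \<partial>lborel \<partial>lborel)
      \<le> (\<integral>\<^sup>+u\<in>cball x a. (ennreal (2 * b) * hl_max (F u) y) \<partial>lborel)"
    by (intro nn_integral_mono mult_right_mono hl_max_ge assms) auto
  also have "\<dots> = ennreal (2 * b) * (\<integral>\<^sup>+u\<in>cball x a. hl_max (F u) y \<partial>lborel)"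
    unfolding mult.assoc by (rule nn_integral_cmult) measurable
  also have "\<dots> \<le> ennreal (2 * b) * (ennreal (2 * a) * strong_max F x y)"
    unfolding strong_max_def by (intro mult_left_mono hl_max_ge assms) auto
  also have "\<dots> = ennreal (4 * a * b) * strong_max F x y"
    using assms by (simp add: mult.assoc[symmetric] ennreal_mult[symmetric]) (simp add: mult.commute mult.left_commute)
  finally show ?thesis .
qed

end

lemma set_nn_integral_le_strong_max:
  fixes g :: "real^2 \<Rightarrow> ennreal"
  assumes [measurable]: "g \<in> borel_measurable borel"
    and ab: "0 < a" "0 < b"
    and sub: "\<And>z. z \<in> S \<Longrightarrow> \<bar>z $ 1 - x $ 1\<bar> \<le> a \<and> \<bar>z $ 2 - x $ 2\<bar> \<le> b"
  shows "(\<integral>\<^sup>+z\<in>S. g z \<partial>lborel) \<le> ennreal (4 * a * b) * strong_max (\<lambda>u v. g (vector [u, v])) (x $ 1) (x $ 2)"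
proof -
  have "(\<integral>\<^sup>+z\<in>S. g z \<partial>lborel)
      \<le> (\<integral>\<^sup>+z. g z * (indicator (cball (x $ 1) a) (z $ 1) * indicator (cball (x $ 2) b) (z $ 2)) \<partial>lborel)"
    using sub by (intro nn_integral_mono mult_left_mono) (auto simp: indicator_def dist_real_def abs_minus_commute)
  also have "\<dots> = (\<integral>\<^sup>+u. \<integral>\<^sup>+v. g (vector [u, v])
      * (indicator (cball (x $ 1) a) u * indicator (cball (x $ 2) b) v) \<partial>lborel \<partial>lborel)"
    by (subst nn_integral_real_2) auto
  also have "\<dots> = (\<integral>\<^sup>+u\<in>cball (x $ 1) a. \<integral>\<^sup>+v\<in>cball (x $ 2) b. g (vector [u, v]) \<partial>lborel \<partial>lborel)"
    by (intro nn_integral_cong) (auto simp: indicator_def)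
  also have "\<dots> \<le> ennreal (4 * a * b) * strong_max (\<lambda>u v. g (vector [u, v])) (x $ 1) (x $ 2)"
    by (rule strong_max_ge) (use ab in auto)
  finally show ?thesis .
qed

lemma mem_rectangle:
  "z \<in> rectangle c \<theta> a b \<longleftrightarrow>
    \<bar>(z $ 1 - c $ 1) * cos \<theta> + (z $ 2 - c $ 2) * sin \<theta>\<bar> \<le> a / 2 \<and>
    \<bar>(z $ 2 - c $ 2) * cos \<theta> - (z $ 1 - c $ 1) * sin \<theta>\<bar> \<le> b / 2"
proof -
  have trig: "cos \<theta> * cos \<theta> + sin \<theta> * sin \<theta> = 1"
    by (rule sin_cos_squared_add3)
  define X Y where "X = z $ 1 - c $ 1" and "Y = z $ 2 - c $ 2"
  have "z = c + u *\<^sub>R vector [cos \<theta>, sin \<theta>] + v *\<^sub>R vector [- sin \<theta>, cos \<theta>] \<longleftrightarrow>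
      X = u * cos \<theta> - v * sin \<theta> \<and> Y = u * sin \<theta> + v * cos \<theta>" for u v
    by (auto simp: X_def Y_def vec_eq_iff forall_2)
  also have "\<dots> u v \<longleftrightarrow> u = X * cos \<theta> + Y * sin \<theta> \<and> v = Y * cos \<theta> - X * sin \<theta>" for u v
    using trig by algebra
  finally have "z = c + u *\<^sub>R vector [cos \<theta>, sin \<theta>] + v *\<^sub>R vector [- sin \<theta>, cos \<theta>] \<longleftrightarrow>
      u = X * cos \<theta> + Y * sin \<theta> \<and> v = Y * cos \<theta> - X * sin \<theta>" for u v .
  then show ?thesis
    unfolding rectangle_def X_def Y_def by auto
qed

lemma closed_rectangle: "closed (rectangle c \<theta> a b)"
proof -
  have "rectangle c \<theta> a b =
    {z. \<bar>(z $ 1 - c $ 1) * cos \<theta> + (z $ 2 - c $ 2) * sin \<theta>\<bar> \<le> a / 2 \<and>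
        \<bar>(z $ 2 - c $ 2) * cos \<theta> - (z $ 1 - c $ 1) * sin \<theta>\<bar> \<le> b / 2}"
    using mem_rectangle by blast
  then show ?thesis
    by (auto intro!: closed_Collect_conj closed_Collect_le continuous_intros)
qed

lemma homothet_rectangle:
  assumes "0 < h"
  shows "(\<lambda>x. d + h *\<^sub>R x) ` rectangle c \<theta> a b = rectangle (d + h *\<^sub>R c) \<theta> (h * a) (h * b)"
proof safe
  fix x assume "x \<in> rectangle c \<theta> a b"
  then obtain u v where x: "x = c + u *\<^sub>R vector [cos \<theta>, sin \<theta>] + v *\<^sub>R vector [- sin \<theta>, cos \<theta>]"
    "\<bar>u\<bar> \<le> a / 2" "\<bar>v\<bar> \<le> b / 2"
    unfolding rectangle_def by blast
  then have "d + h *\<^sub>R x = d + h *\<^sub>R c + (h * u) *\<^sub>R vector [cos \<theta>, sin \<theta>] + (h * v) *\<^sub>R vector [- sin \<theta>, cos \<theta>]"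
    "\<bar>h * u\<bar> \<le> h * a / 2" "\<bar>h * v\<bar> \<le> h * b / 2"
    using assms mult_left_mono[of "\<bar>u\<bar>" "a / 2" h] mult_left_mono[of "\<bar>v\<bar>" "b / 2" h]
    by (auto simp: scaleR_right_distrib abs_mult)
  then show "d + h *\<^sub>R x \<in> rectangle (d + h *\<^sub>R c) \<theta> (h * a) (h * b)"
    unfolding rectangle_def by blast
next
  fix y assume "y \<in> rectangle (d + h *\<^sub>R c) \<theta> (h * a) (h * b)"
  then obtain u v where y: "y = d + h *\<^sub>R c + u *\<^sub>R vector [cos \<theta>, sin \<theta>] + v *\<^sub>R vector [- sin \<theta>, cos \<theta>]"
    "\<bar>u\<bar> \<le> h * a / 2" "\<bar>v\<bar> \<le> h * b / 2"
    unfolding rectangle_def by blast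
  define x where "x = c + (u / h) *\<^sub>R vector [cos \<theta>, sin \<theta>] + (v / h) *\<^sub>R vector [- sin \<theta>, cos \<theta>]"
  have "\<bar>u / h\<bar> \<le> a / 2" "\<bar>v / h\<bar> \<le> b / 2"
    using y(2,3) assms by (simp_all add: abs_div field_simps)
  then have "x \<in> rectangle c \<theta> a b"
    unfolding rectangle_def x_def by blast
  moreover have "y = d + h *\<^sub>R x"
    using assms by (simp add: x_def y(1) scaleR_right_distrib)
  ultimately show "y \<in> (\<lambda>x. d + h *\<^sub>R x) ` rectangle c \<theta> a b" by blast
qed

lemma rectangle_width_bounds:
  assumes "z \<in> rectangle c \<theta> a b" "x \<in> rectangle c \<theta> a b"
  shows "\<bar>z $ 1 - x $ 1\<bar> \<le> a * \<bar>cos \<theta>\<bar> + b * \<bar>sin \<theta>\<bar>" "\<bar>z $ 2 - x $ 2\<bar> \<le> a * \<bar>sin \<theta>\<bar> + b * \<bar>cos \<theta>\<bar>"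
proof -
  obtain u v u' v' where
    z: "z = c + u *\<^sub>R vector [cos \<theta>, sin \<theta>] + v *\<^sub>R vector [- sin \<theta>, cos \<theta>]" and
    x: "x = c + u' *\<^sub>R vector [cos \<theta>, sin \<theta>] + v' *\<^sub>R vector [- sin \<theta>, cos \<theta>]" and
    uv: "\<bar>u\<bar> \<le> a / 2" "\<bar>v\<bar> \<le> b / 2" "\<bar>u'\<bar> \<le> a / 2" "\<bar>v'\<bar> \<le> b / 2"
    using assms unfolding rectangle_def by blast
  have ab: "\<bar>u - u'\<bar> \<le> a" "\<bar>v - v'\<bar> \<le> b" using uv by auto
  have "\<bar>z $ 1 - x $ 1\<bar> = \<bar>(u - u') * cos \<theta> - (v - v') * sin \<theta>\<bar>"
    unfolding z x by (simp add: algebra_simps)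
  also have "\<dots> \<le> \<bar>u - u'\<bar> * \<bar>cos \<theta>\<bar> + \<bar>v - v'\<bar> * \<bar>sin \<theta>\<bar>"
    unfolding abs_mult[symmetric] by (rule abs_triangle_ineq4)
  also have "\<dots> \<le> a * \<bar>cos \<theta>\<bar> + b * \<bar>sin \<theta>\<bar>"
    by (intro add_mono mult_right_mono ab) auto
  finally show "\<bar>z $ 1 - x $ 1\<bar> \<le> a * \<bar>cos \<theta>\<bar> + b * \<bar>sin \<theta>\<bar>" .
  have "\<bar>z $ 2 - x $ 2\<bar> = \<bar>(u - u') * sin \<theta> + (v - v') * cos \<theta>\<bar>"
    unfolding z x by (simp add: algebra_simps)
  also have "\<dots> \<le> \<bar>u - u'\<bar> * \<bar>sin \<theta>\<bar> + \<bar>v - v'\<bar> * \<bar>cos \<theta>\<bar>"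
    unfolding abs_mult[symmetric] by (rule abs_triangle_ineq)
  also have "\<dots> \<le> a * \<bar>sin \<theta>\<bar> + b * \<bar>cos \<theta>\<bar>"
    by (intro add_mono mult_right_mono ab) auto
  finally show "\<bar>z $ 2 - x $ 2\<bar> \<le> a * \<bar>sin \<theta>\<bar> + b * \<bar>cos \<theta>\<bar>" .
qed

lemma emeasure_rectangle_ge:
  assumes "0 < l" "l \<le> L" "0 \<le> C" "\<bar>\<theta>\<bar> * L \<le> C * l"
  shows "ennreal (L * l / (4 * (C + 1))) \<le> emeasure lborel (rectangle c \<theta> L l)"
proof -
  define d :: "real^2" where "d = vector [L / (4 * (C + 1)), l / 4]"
  have d: "0 < d $ 1" "0 < d $ 2" "d $ 1 \<le> L / 4" "\<bar>\<theta>\<bar> * d $ 1 \<le> l / 4"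
  proof -
    show "0 < d $ 1" "0 < d $ 2" "d $ 1 \<le> L / 4" using assms by (auto simp: d_def field_simps)
    have "\<bar>\<theta>\<bar> * L \<le> (C + 1) * l"
      using assms by (simp add: algebra_simps)
    then show "\<bar>\<theta>\<bar> * d $ 1 \<le> l / 4"
      using assms by (simp add: d_def field_simps)
  qed
  have "cbox (c - d) (c + d) \<subseteq> rectangle c \<theta> L l"
  proof
    fix z assume z: "z \<in> cbox (c - d) (c + d)"
    define x y where "x = z $ 1 - c $ 1" and "y = z $ 2 - c $ 2"
    have xy: "\<bar>x\<bar> \<le> d $ 1" "\<bar>y\<bar> \<le> l / 4"
    proof -
      have "c $ 1 - d $ 1 \<le> z $ 1" "z $ 1 \<le> c $ 1 + d $ 1" "c $ 2 - d $ 2 \<le> z $ 2" "z $ 2 \<le> c $ 2 + d $ 2"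
        using z by (auto simp: mem_box_cart forall_2)
      moreover have "d $ 2 = l / 4" by (simp add: d_def)
      ultimately show "\<bar>x\<bar> \<le> d $ 1" "\<bar>y\<bar> \<le> l / 4"
        unfolding x_def y_def by linarith+
    qed
    have *: "\<bar>w * cos \<theta>\<bar> \<le> \<bar>w\<bar>" "\<bar>w * sin \<theta>\<bar> \<le> \<bar>w\<bar>" "\<bar>w * sin \<theta>\<bar> \<le> \<bar>\<theta>\<bar> * \<bar>w\<bar>" for w
      using mult_left_mono[of "\<bar>cos \<theta>\<bar>" 1 "\<bar>w\<bar>"] mult_left_mono[of "\<bar>sin \<theta>\<bar>" 1 "\<bar>w\<bar>"]
        mult_left_mono[of "\<bar>sin \<theta>\<bar>" "\<bar>\<theta>\<bar>" "\<bar>w\<bar>"] abs_sin_x_le_abs_x[of \<theta>]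
      by (auto simp: abs_mult mult.commute)
    have th: "\<bar>\<theta>\<bar> * \<bar>x\<bar> \<le> l / 4"
      using mult_left_mono[OF xy(1), of "\<bar>\<theta>\<bar>"] d(4) by simp
    have "\<bar>x * cos \<theta> + y * sin \<theta>\<bar> \<le> L / 2"
      using *(1)[of x] *(2)[of y] xy d assms by linarith
    moreover have "\<bar>y * cos \<theta> - x * sin \<theta>\<bar> \<le> l / 2"
      using *(1)[of y] *(3)[of x] xy th by linarith
    ultimately show "z \<in> rectangle c \<theta> L l"
      by (simp add: mem_rectangle x_def y_def)
  qed
  moreover have "emeasure lborel (cbox (c - d) (c + d)) = ennreal (L * l / (4 * (C + 1)))"
  proof -
    have "(c - d) \<bullet> b \<le> (c + d) \<bullet> b" if "b \<in> Basis" for b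
      using that d by (auto simp: Basis_real_2 inner_axis)
    then show ?thesis
      by (subst emeasure_lborel_cbox) (auto simp: prod_Basis_real_2 inner_axis d_def field_simps)
  qed
  ultimately show ?thesis
    using emeasure_mono[of "cbox (c - d) (c + d)" "rectangle c \<theta> L l" lborel] closed_rectangle
    by simp
qed

text \<open>Dilating a rectangle slightly about its centre turns a point of it into an interior point
  and changes the average by a factor close to 1, so the superlevel sets are open even though the
  rectangles are closed.\<close>

lemma maximal_op_measurable:
  assumes B: "\<And>R. R \<in> B \<Longrightarrow> \<exists>c \<theta> a b. 0 < a \<and> 0 < b \<and> R = rectangle c \<theta> a b"
  shows "maximal_op B f \<in> borel_measurable borel"
proof (rule borel_measurableI_greater)
  fix s :: ennreal
  have "open {x. s < maximal_op B f x}"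
    unfolding open_dist
  proof safe
    fix x assume "s < maximal_op B f x"
    then obtain R where R: "R \<in> homothets B" "x \<in> R"
      and avg: "s < (\<integral>\<^sup>+y\<in>R. ennreal \<bar>f y\<bar> \<partial>lebesgue) / emeasure lebesgue R"
      unfolding maximal_op_def by (auto simp: less_SUP_iff)
    define av where "av = (\<integral>\<^sup>+y\<in>R. ennreal \<bar>f y\<bar> \<partial>lebesgue) / emeasure lebesgue R"
    have sR: "s < av"
      using avg by (simp only: av_def)
    from R(1) obtain d h R0 where R0: "0 < h" "R0 \<in> B" "R = (\<lambda>x. d + h *\<^sub>R x) ` R0"
      unfolding homothets_def by blast
    from B[OF R0(2)] obtain c0 \<theta> a0 b0 where r0: "0 < a0" "0 < b0" "R0 = rectangle c0 \<theta> a0 b0"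
      by blast
    define c a b where "c = d + h *\<^sub>R c0" and "a = h * a0" and "b = h * b0"
    have Req: "R = rectangle c \<theta> a b" and ab: "0 < a" "0 < b"
      using R0 r0 homothet_rectangle[OF R0(1)] by (auto simp: c_def a_def b_def)
    obtain r where r: "1 < r" "s < ennreal (inverse (r\<^sup>2)) * av"
    proof (cases "av = top")
      case True
      have "s < ennreal (inverse (2\<^sup>2)) * av"
        using sR by (simp add: True ennreal_mult_top)
      then show ?thesis using that[of 2] by simp
    next
      case False
      then obtain A where A: "av = ennreal A" "0 \<le> A" by (metis ennreal_cases)
      obtain s' where s': "s = ennreal s'" "0 \<le> s'"
        using sR by (cases s) auto
      then have "s' < A"
        using sR A by (simp add: ennreal_less_iff)
      have "((\<lambda>r. inverse (r\<^sup>2) * A) \<longlongrightarrow> inverse (1\<^sup>2) * A) (at_right 1)"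
        by (intro tendsto_intros) auto
      then have "eventually (\<lambda>r. s' < inverse (r\<^sup>2) * A) (at_right 1)"
        using \<open>s' < A\<close> by (intro order_tendstoD) auto
      moreover have "eventually (\<lambda>r::real. 1 < r) (at_right 1)"
        by (rule eventually_at_right_less)
      ultimately have "eventually (\<lambda>r. 1 < r \<and> s' < inverse (r\<^sup>2) * A) (at_right 1)"
        by eventually_elim auto
      then obtain r where "1 < r" "s' < inverse (r\<^sup>2) * A"
        using eventually_happens'[OF trivial_limit_at_right_real] by blast
      then show ?thesis
        using that[of r] s' A by (simp add: ennreal_mult[symmetric] ennreal_less_iff)
    qed
    define S where "S = rectangle c \<theta> (r * a) (r * b)"
    have S_img: "S = (\<lambda>x. (c - r *\<^sub>R c) + r *\<^sub>R x) ` R"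
      unfolding S_def Req using r by (subst homothet_rectangle) auto
    have "S = (\<lambda>x. ((c - r *\<^sub>R c) + r *\<^sub>R d) + (r * h) *\<^sub>R x) ` R0"
      unfolding S_img R0(3) by (simp add: image_image scaleR_right_distrib add.assoc)
    then have S_hom: "S \<in> homothets B"
      unfolding homothets_def using r R0 by force
    have "R \<subseteq> S"
    proof
      fix z assume "z \<in> R"
      moreover have "a \<le> r * a" "b \<le> r * b" using r ab by auto
      ultimately show "z \<in> S" by (auto simp: S_def Req mem_rectangle)
    qed
    have emS: "emeasure lebesgue S = ennreal (r\<^sup>2) * emeasure lebesgue R"
      using emeasure_lebesgue_affine[of r "c - r *\<^sub>R c" R] r by (simp add: S_img add.commute power2_eq_square)
    have "s < ennreal (inverse (r\<^sup>2)) * av" by fact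
    also have "\<dots> = (\<integral>\<^sup>+y\<in>R. ennreal \<bar>f y\<bar> \<partial>lebesgue) / emeasure lebesgue S"
    proof -
      have "inverse (ennreal (r\<^sup>2) * emeasure lebesgue R) = inverse (ennreal (r\<^sup>2)) * inverse (emeasure lebesgue R)"
        using r by (intro ennreal_inverse_mult') auto
      then show ?thesis
        using r by (simp add: av_def divide_ennreal_def emS inverse_ennreal mult.commute mult.left_commute)
    qed
    also have "\<dots> \<le> (\<integral>\<^sup>+y\<in>S. ennreal \<bar>f y\<bar> \<partial>lebesgue) / emeasure lebesgue S"
      using \<open>R \<subseteq> S\<close> by (intro divide_right_mono_ennreal nn_integral_mono) (auto simp: indicator_def)
    finally have sS: "s < (\<integral>\<^sup>+y\<in>S. ennreal \<bar>f y\<bar> \<partial>lebesgue) / emeasure lebesgue S" .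
    define \<epsilon> where "\<epsilon> = ((r - 1) * min a b) / 4"
    have \<epsilon>: "0 < \<epsilon>" "a / 2 + 2 * \<epsilon> \<le> r * a / 2" "b / 2 + 2 * \<epsilon> \<le> r * b / 2"
    proof -
      show "0 < \<epsilon>" using r ab by (simp add: \<epsilon>_def)
      have "(r - 1) * min a b \<le> (r - 1) * a" "(r - 1) * min a b \<le> (r - 1) * b"
        using r by (intro mult_left_mono; simp)+
      then have "4 * \<epsilon> \<le> r * a - a" "4 * \<epsilon> \<le> r * b - b"
        by (simp_all add: \<epsilon>_def left_diff_distrib)
      then show "a / 2 + 2 * \<epsilon> \<le> r * a / 2" "b / 2 + 2 * \<epsilon> \<le> r * b / 2"
        by linarith+
    qed
    have "y \<in> S" if "dist y x < \<epsilon>" for y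
    proof -
      define u v where "u = y $ 1 - x $ 1" and "v = y $ 2 - x $ 2"
      have uv: "\<bar>u\<bar> \<le> \<epsilon>" "\<bar>v\<bar> \<le> \<epsilon>"
        using that component_le_norm_cart[of "y - x" 1] component_le_norm_cart[of "y - x" 2]
        by (auto simp: u_def v_def dist_norm)
      have *: "\<bar>w * cos \<theta>\<bar> \<le> \<bar>w\<bar>" "\<bar>w * sin \<theta>\<bar> \<le> \<bar>w\<bar>" for w
        using mult_left_mono[of "\<bar>cos \<theta>\<bar>" 1 "\<bar>w\<bar>"] mult_left_mono[of "\<bar>sin \<theta>\<bar>" 1 "\<bar>w\<bar>"]
        by (auto simp: abs_mult)
      have eq: "(y $ 1 - c $ 1) * cos \<theta> + (y $ 2 - c $ 2) * sin \<theta>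
          = ((x $ 1 - c $ 1) * cos \<theta> + (x $ 2 - c $ 2) * sin \<theta>) + u * cos \<theta> + v * sin \<theta>"
        "(y $ 2 - c $ 2) * cos \<theta> - (y $ 1 - c $ 1) * sin \<theta>
          = ((x $ 2 - c $ 2) * cos \<theta> - (x $ 1 - c $ 1) * sin \<theta>) + v * cos \<theta> - u * sin \<theta>"
        by (simp_all add: u_def v_def algebra_simps)
      have tri: "\<bar>m + w + w'\<bar> \<le> k'" "\<bar>m + w - w'\<bar> \<le> k'"
        if "\<bar>m\<bar> \<le> k" "\<bar>w\<bar> \<le> \<epsilon>" "\<bar>w'\<bar> \<le> \<epsilon>" "k + 2 * \<epsilon> \<le> k'" for m w w' k k' :: real
        using that by linarith+
      have "x \<in> rectangle c \<theta> a b" using R(2) Req by simp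
      then show "y \<in> S"
        unfolding S_def mem_rectangle eq
        by (intro conjI tri[OF _ order_trans[OF *(1) uv(1)] order_trans[OF *(2) uv(2)] \<epsilon>(2)]
            tri[OF _ order_trans[OF *(1) uv(2)] order_trans[OF *(2) uv(1)] \<epsilon>(3)]) auto
    qed
    moreover have "s < maximal_op B f y" if "y \<in> S" for y
      using sS S_hom that unfolding maximal_op_def by (auto simp: less_SUP_iff)
    ultimately show "\<exists>\<epsilon>>0. \<forall>y. dist y x < \<epsilon> \<longrightarrow> y \<in> {x. s < maximal_op B f x}"
      using \<epsilon>(1) by blast
  qed
  then show "{x \<in> space borel. s < maximal_op B f x} \<in> sets borel"
    by simp
qed

lemma maximal_op_le_AE:
  assumes f: "AE x in lebesgue. ennreal \<bar>f x\<bar> \<le> 1"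
    and B: "\<And>R. R \<in> homothets B \<Longrightarrow> R \<in> sets lebesgue"
  shows "maximal_op B f x \<le> 1"
  unfolding maximal_op_def
proof (rule SUP_least)
  fix R assume "R \<in> {R \<in> homothets B. x \<in> R}"
  then have R: "R \<in> sets lebesgue" using B by blast
  have "(\<integral>\<^sup>+y\<in>R. ennreal \<bar>f y\<bar> \<partial>lebesgue) \<le> (\<integral>\<^sup>+y. indicator R y \<partial>lebesgue)"
    using f by (intro nn_integral_mono_AE) (auto simp: indicator_def)
  then have "(\<integral>\<^sup>+y\<in>R. ennreal \<bar>f y\<bar> \<partial>lebesgue) / emeasure lebesgue R
      \<le> emeasure lebesgue R / emeasure lebesgue R"
    using R by (intro divide_right_mono_ennreal) simp
  also have "\<dots> \<le> 1"
    by (cases "emeasure lebesgue R = 0"; cases "emeasure lebesgue R = top") (auto simp: less_top)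
  finally show "(\<integral>\<^sup>+y\<in>R. ennreal \<bar>f y\<bar> \<partial>lebesgue) / emeasure lebesgue R \<le> 1" .
qed

lemma ennreal_inverse_antimono:
  fixes a b :: ennreal
  shows "a \<le> b \<Longrightarrow> inverse b \<le> inverse a"
proof (cases "a = 0")
  case False
  assume "a \<le> b"
  with False show ?thesis
    by (cases a; cases b) (auto simp: inverse_ennreal top_unique intro!: ennreal_leI le_imp_inverse_le)
qed simp

lemma average_le_strong_max:
  assumes g [measurable]: "g \<in> borel_measurable borel"
    and l: "0 < l" "l \<le> L" "0 \<le> C" "\<bar>\<theta>\<bar> * L \<le> C * l"
    and x: "x \<in> rectangle c \<theta> L l"
  shows "(\<integral>\<^sup>+y\<in>rectangle c \<theta> L l. g y \<partial>lborel) / emeasure lborel (rectangle c \<theta> L l)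
    \<le> ennreal (32 * (C + 1)\<^sup>2) * strong_max (\<lambda>u v. g (vector [u, v])) (x $ 1) (x $ 2)"
proof -
  let ?R = "rectangle c \<theta> L l" and ?H = "strong_max (\<lambda>u v. g (vector [u, v])) (x $ 1) (x $ 2)"
  let ?m = "L * l / (4 * (C + 1))"
  have L: "0 < L" using l by simp
  define A where "A = 4 * (2 * L) * ((C + 1) * l)"
  have m: "0 < ?m" and A: "0 \<le> A" using l L by (simp_all add: A_def)
  have le: "(\<integral>\<^sup>+y\<in>?R. g y \<partial>lborel) \<le> ennreal A * ?H"
    unfolding A_def
  proof (rule set_nn_integral_le_strong_max)
    fix z assume z: "z \<in> ?R"
    have "L * \<bar>cos \<theta>\<bar> \<le> L" "l * \<bar>sin \<theta>\<bar> \<le> l" "l * \<bar>cos \<theta>\<bar> \<le> l"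
      using l L by simp_all
    moreover have "L * \<bar>sin \<theta>\<bar> \<le> L * \<bar>\<theta>\<bar>"
      using L abs_sin_x_le_abs_x by simp
    moreover have "L * \<bar>\<theta>\<bar> \<le> C * l" "(C + 1) * l = C * l + l"
      using l by (simp_all add: algebra_simps)
    ultimately show "\<bar>z $ 1 - x $ 1\<bar> \<le> 2 * L \<and> \<bar>z $ 2 - x $ 2\<bar> \<le> (C + 1) * l"
      using rectangle_width_bounds[OF z x] l by (intro conjI) linarith+
  qed (use l L in auto)
  have "(\<integral>\<^sup>+y\<in>?R. g y \<partial>lborel) / emeasure lborel ?R \<le> (\<integral>\<^sup>+y\<in>?R. g y \<partial>lborel) / ennreal ?m"
    unfolding divide_ennreal_def
    by (intro mult_left_mono ennreal_inverse_antimono emeasure_rectangle_ge l) simp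
  also have "\<dots> \<le> ennreal A * ?H / ennreal ?m"
    by (intro divide_right_mono_ennreal le)
  also have "\<dots> = ennreal (A * inverse ?m) * ?H"
    using A m unfolding divide_ennreal_def
    by (subst inverse_ennreal, simp, subst ennreal_mult) (simp_all only: ac_simps less_imp_le inverse_nonnegative_iff_nonnegative)
  also have "A * inverse ?m = 32 * (C + 1)\<^sup>2"
    using l L by (simp add: A_def field_simps power2_eq_square)
  finally show ?thesis .
qed

theorem theorem8:
  fixes t e :: "nat \<Rightarrow> real" and R :: "nat \<Rightarrow> (real^2) set" and C :: real
  assumes "\<And>k. 1 \<le> k \<Longrightarrow> 0 \<le> t k \<and> t k \<le> pi / 4"
    and "\<And>j k. 1 \<le> j \<Longrightarrow> j \<le> k \<Longrightarrow> t k \<le> t j"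
    and "t \<longlonglongrightarrow> 0"
    and "\<And>k. 1 \<le> k \<Longrightarrow> 0 < e k \<and> e k \<le> 1"
    and "\<And>k. 1 \<le> k \<Longrightarrow> rectangle_ecc_orient (R k) (e k) (t k)"
    and "C > 0"
    and "\<And>k. 1 \<le> k \<Longrightarrow> t k \<le> C * e k"
  shows "good_operator (maximal_op (R ` {1..}))"
proof -
  let ?B = "R ` {1..}"
  have B: "\<exists>c \<theta> L l. 0 < l \<and> l \<le> L \<and> \<bar>\<theta>\<bar> * L \<le> C * l \<and> Q = rectangle c \<theta> L l" if Q: "Q \<in> ?B" for Q
  proof -
    obtain k where k: "1 \<le> k" "Q = R k" using Q by auto
    obtain c L l where r: "0 < l" "l \<le> L" "R k = rectangle c (t k) L l" "e k = l / L"
      using assms(5)[OF k(1)] unfolding rectangle_ecc_orient_def by blast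
    have "\<bar>t k\<bar> * L \<le> C * l"
      using assms(1,7)[OF k(1)] r by (simp add: field_simps)
    then show ?thesis using r k by blast
  qed
  have hB: "\<exists>c \<theta> L l. 0 < l \<and> l \<le> L \<and> \<bar>\<theta>\<bar> * L \<le> C * l \<and> Q = rectangle c \<theta> L l"
    if "Q \<in> homothets ?B" for Q
  proof -
    from that obtain d h Q0 where Q0: "0 < h" "Q0 \<in> ?B" "Q = (\<lambda>x. d + h *\<^sub>R x) ` Q0"
      unfolding homothets_def by blast
    from B[OF Q0(2)] obtain c \<theta> L l where
      r: "0 < l" "l \<le> L" "\<bar>\<theta>\<bar> * L \<le> C * l" "Q0 = rectangle c \<theta> L l"
      by blast
    have "Q = rectangle (d + h *\<^sub>R c) \<theta> (h * L) (h * l)"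
      using Q0 r homothet_rectangle by simp
    moreover have "\<bar>\<theta>\<bar> * (h * L) \<le> C * (h * l)"
      using mult_left_mono[OF r(3), of h] Q0(1) by (simp add: ac_simps)
    moreover have "0 < h * l" "h * l \<le> h * L"
      using Q0(1) r by simp_all
    ultimately show ?thesis by blast
  qed
  have meas: "maximal_op ?B f \<in> borel_measurable lebesgue" for f
  proof -
    have "maximal_op ?B f \<in> borel_measurable borel"
    proof (rule maximal_op_measurable)
      fix Q assume "Q \<in> ?B"
      from B[OF this] obtain c \<theta> L l where "0 < l" "l \<le> L" "Q = rectangle c \<theta> L l"
        by blast
      then show "\<exists>c \<theta> a b. 0 < a \<and> 0 < b \<and> Q = rectangle c \<theta> a b"
        using order_less_le_trans by blast
    qed
    then show ?thesis by (simp add: measurable_completion)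
  qed
  have "bounded_on_Lp p (maximal_op ?B)" if p: "1 < p" for p
  proof (cases "p = top")
    case True
    have "Lp_norm p (maximal_op ?B f) \<le> 1" if "Lp_norm p (\<lambda>x. ennreal \<bar>f x\<bar>) = 1" for f
    proof -
      have "AE x in lebesgue. ennreal \<bar>f x\<bar> \<le> 1"
        using esssup_AE[where M = lebesgue and f = "\<lambda>x. ennreal \<bar>f x\<bar>"] that True by (simp add: Lp_norm_def)
      moreover have "Q \<in> sets lebesgue" if "Q \<in> homothets ?B" for Q
        using hB[OF that] closed_rectangle by auto
      ultimately have "maximal_op ?B f x \<le> 1" for x
        by (rule maximal_op_le_AE)
      then show ?thesis
        using meas True by (auto simp: Lp_norm_def intro!: esssup_I)
    qed
    then have "Lp_op_norm p (maximal_op ?B) \<le> 1"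
      unfolding Lp_op_norm_def by (auto intro!: SUP_least)
    then show ?thesis
      unfolding bounded_on_Lp_def by (rule order_le_less_trans) simp
  next
    case False
    define q where "q = enn2real p"
    have q: "1 < q"
      using p False by (cases p) (auto simp: q_def)
    define K where "K = (32 * (C + 1)\<^sup>2) powr q * (20 * q / (q - 1) * 4 powr (q - 1))\<^sup>2"
    have "Lp_norm p (maximal_op ?B f) \<le> ennreal_powr (ennreal K) (1 / q)"
      if f: "f \<in> borel_measurable lebesgue" "Lp_norm p (\<lambda>x. ennreal \<bar>f x\<bar>) = 1" for f
    proof -
      obtain f' where [measurable]: "f' \<in> borel_measurable lborel" and ae: "AE x in lborel. f x = f' x"
        using completion_ex_borel_measurable_real[OF f(1)] by blast
      define g where "g z = ennreal \<bar>f' z\<bar>" for z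
      have [measurable]: "g \<in> borel_measurable borel" unfolding g_def by measurable
      have aeg: "AE x in lborel. ennreal \<bar>f x\<bar> = g x"
        using ae by eventually_elim (simp add: g_def)
      let ?F = "\<lambda>u v. g (vector [u, v])"
      let ?H = "\<lambda>x::real^2. strong_max ?F (x $ 1) (x $ 2)"
      have [measurable]: "(\<lambda>(u, v). strong_max ?F u v) \<in> borel_measurable (borel \<Otimes>\<^sub>M borel)"
        by (rule strong_max_measurable) measurable
      have bound: "maximal_op ?B f x \<le> ennreal (32 * (C + 1)\<^sup>2) * ?H x" for x
        unfolding maximal_op_def
      proof (rule SUP_least, clarify)
        fix Q assume Q: "Q \<in> homothets ?B" "x \<in> Q"
        from hB[OF Q(1)] obtain c \<theta> L l where
          r: "0 < l" "l \<le> L" "\<bar>\<theta>\<bar> * L \<le> C * l" and Q_eq: "Q = rectangle c \<theta> L l"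
          by blast
        have "(\<integral>\<^sup>+y\<in>Q. ennreal \<bar>f y\<bar> \<partial>lebesgue) = (\<integral>\<^sup>+y\<in>Q. g y \<partial>lborel)"
          unfolding nn_integral_completion using aeg by (intro nn_integral_cong_AE) auto
        moreover have "emeasure lebesgue Q = emeasure lborel Q"
          using closed_rectangle by (simp add: Q_eq)
        ultimately show "(\<integral>\<^sup>+y\<in>Q. ennreal \<bar>f y\<bar> \<partial>lebesgue) / emeasure lebesgue Q
            \<le> ennreal (32 * (C + 1)\<^sup>2) * ?H x"
          using average_le_strong_max[of g l L C \<theta> x c] Q r assms(6)
          by (simp add: Q_eq)
      qed
      have "ennreal_powr (\<integral>\<^sup>+x. ennreal_powr (ennreal \<bar>f x\<bar>) q \<partial>lebesgue) (1 / q) = 1"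
        using f(2) False by (simp add: Lp_norm_def q_def)
      then have "(\<integral>\<^sup>+x. ennreal_powr (ennreal \<bar>f x\<bar>) q \<partial>lebesgue) = 1"
        using q ennreal_powr_inverse[of q "\<integral>\<^sup>+x. ennreal_powr (ennreal \<bar>f x\<bar>) q \<partial>lebesgue"]
        by (simp add: ennreal_powr_def)
      then have one: "(\<integral>\<^sup>+x. ennreal_powr (g x) q \<partial>lborel) = 1"
        unfolding nn_integral_completion
        using aeg by (subst nn_integral_cong_AE[where v = "\<lambda>x. ennreal_powr (ennreal \<bar>f x\<bar>) q"]) auto
      have "(\<integral>\<^sup>+x. ennreal_powr (maximal_op ?B f x) q \<partial>lebesgue)
          \<le> (\<integral>\<^sup>+x. ennreal_powr (ennreal (32 * (C + 1)\<^sup>2) * ?H x) q \<partial>lborel)"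
        unfolding nn_integral_completion using q by (intro nn_integral_mono ennreal_powr_mono bound) simp
      also have "\<dots> = ennreal ((32 * (C + 1)\<^sup>2) powr q) * (\<integral>\<^sup>+x. ennreal_powr (?H x) q \<partial>lborel)"
        using q by (simp add: ennreal_powr_mult ennreal_powr_ennreal nn_integral_cmult)
      also have "(\<integral>\<^sup>+x. ennreal_powr (?H x) q \<partial>lborel)
          = (\<integral>\<^sup>+x. \<integral>\<^sup>+y. ennreal_powr (strong_max ?F x y) q \<partial>lborel \<partial>lborel)"
        by (subst nn_integral_real_2) auto
      also have "\<dots> \<le> ennreal ((20 * q / (q - 1) * 4 powr (q - 1))\<^sup>2)
          * (\<integral>\<^sup>+x. \<integral>\<^sup>+y. ennreal_powr (?F x y) q \<partial>lborel \<partial>lborel)"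
        by (rule strong_max_strong_type[OF _ q]) measurable
      also have "(\<integral>\<^sup>+x. \<integral>\<^sup>+y. ennreal_powr (?F x y) q \<partial>lborel \<partial>lborel) = 1"
        using one by (subst (asm) nn_integral_real_2) auto
      finally have "(\<integral>\<^sup>+x. ennreal_powr (maximal_op ?B f x) q \<partial>lebesgue) \<le> ennreal K"
        by (simp add: K_def ennreal_mult mult_left_mono)
      then show ?thesis
        using q False by (auto simp: Lp_norm_def q_def[symmetric] intro!: ennreal_powr_mono)
    qed
    then have "Lp_op_norm p (maximal_op ?B) \<le> ennreal_powr (ennreal K) (1 / q)"
      unfolding Lp_op_norm_def by (auto intro!: SUP_least)
    also have "\<dots> < top"
      by (simp add: ennreal_powr_def)
    finally show ?thesis
      unfolding bounded_on_Lp_def .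
  qed
  then show ?thesis
    unfolding good_operator_def by blast
qed

end
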